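(* Let $\mathcal I=\{1,\dots,n\}$ and let $W=(w_{ij})\in\mathbb R^{n\times n}$ be an interaction matrix with zero diagonal and row sums $1$ in which all connections are of equal weight, that is, for each $i\in\mathcal I$ every positive entry $w_{ij}$ of row $i$ equals $\big(\sum_{k\in\mathcal I}1_{w_{ik}>0}\big)^{-1}$. Let $b_i=b$ and $\gamma_i=\gamma\ge0$ for all $i\in\mathcal I$, with $b>\gamma$. Fix $j\in\mathcal I$, let $\mathcal N=\mathcal I\setminus\{j\}$, and suppose $a_i-p_i=\alpha>0$ for all $i\in\mathcal N$, while user $j$ is a "high consumer", i.e. $a_j-p_j=\bar\alpha>n\alpha$. Let $\mathcal C_j=\{i\in\mathcal N: w_{ij}>0\}$ be the set of neighbors of $j$. Let $\mathbf x^\ast=(x_1^\ast,\dots,x_n^\ast)$ be the equilibrium consumption. Then, independently of the network topology, for all users $i\in\mathcal C_j$, $x_i^\ast$ is increasing in $\gamma$ for small enough values of $\gamma$, whereas $x_j^\ast$ is strictly monotonically decreasing in $\gamma$.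
   Context: User $i$ with parameters $a_i,b_i,\gamma_i$ facing unit price $p_i$ chooses consumption $x_i\ge0$ to maximize $a_ix_i-b_ix_i^2-p_ix_i+\gamma_ix_i(\sum_kw_{ik}x_k-x_i)$. The equilibrium consumption is the unique Nash equilibrium $\mathbf x^\ast=(B+2\Gamma-\Gamma W)^{-1}(\mathbf a-\mathbf p)$, where $B=\mathrm{diag}(2b_1,\dots,2b_n)$ and $\Gamma=\mathrm{diag}(\gamma_1,\dots,\gamma_n)$. Monotonicity in $\gamma$ is with all other parameters fixed and $\gamma$ ranging over $0\le\gamma<b$. *)

theory Defs
  imports "HOL-Analysis.Analysis"
begin

text \<open>The set of users is the finite type \<open>'n\<close>, so \<open>n = CARD('n)\<close>; \<open>W $ i $ k\<close> is \<open>w\<^sub>i\<^sub>k\<close>.\<close>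

definition payoff ::
  "real^'n^'n \<Rightarrow> real^'n \<Rightarrow> real^'n \<Rightarrow> real^'n \<Rightarrow> real^'n \<Rightarrow> real^'n \<Rightarrow> 'n::finite \<Rightarrow> real" where
  "payoff W a b \<gamma> p x i =
     a $ i * x $ i - b $ i * (x $ i)^2 - p $ i * x $ i
       + \<gamma> $ i * x $ i * ((\<Sum>k\<in>UNIV. W $ i $ k * x $ k) - x $ i)"

definition nash_equilibrium ::
  "real^'n^'n \<Rightarrow> real^'n \<Rightarrow> real^'n \<Rightarrow> real^'n \<Rightarrow> real^'n \<Rightarrow> real^'n::finite \<Rightarrow> bool" where
  "nash_equilibrium W a b \<gamma> p x \<longleftrightarrow>
     (\<forall>i. 0 \<le> x $ i) \<and>
     (\<forall>i. \<forall>y\<ge>0. payoff W a b \<gamma> p (\<chi> k. if k = i then y else x $ k) i \<le> payoff W a b \<gamma> p x i)"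

text \<open>\<open>THE\<close> is well defined in the setting of interest, by \<open>equilibrium_unique\<close> below, and
  \<open>equilibrium_eq\<close> gives the closed form.\<close>

definition equilibrium ::
  "real^'n^'n \<Rightarrow> real^'n \<Rightarrow> real^'n \<Rightarrow> real^'n \<Rightarrow> real^'n \<Rightarrow> real^'n::finite" where
  "equilibrium W a b \<gamma> p = (THE x. nash_equilibrium W a b \<gamma> p x)"

definition diag :: "real^'n \<Rightarrow> real^'n^'n::finite" where
  "diag v = (\<chi> i k. if i = k then v $ i else 0)"

definition system_matrix :: "real^'n^'n \<Rightarrow> real^'n \<Rightarrow> real^'n \<Rightarrow> real^'n^'n::finite" where
  "system_matrix W b \<gamma> = diag (2 *\<^sub>R b) + 2 *\<^sub>R diag \<gamma> - diag \<gamma> ** W"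

lemma system_matrix_mult:
  fixes W :: "real^'n^'n::finite"
  shows "(system_matrix W b \<gamma> *v x) $ i
    = 2 * (b $ i + \<gamma> $ i) * x $ i - \<gamma> $ i * (\<Sum>k\<in>UNIV. W $ i $ k * x $ k)"
proof -
  have d: "(diag v *v y) $ l = v $ l * y $ l" for v y :: "real^'n" and l
  proof -
    have "(diag v *v y) $ l = (\<Sum>k\<in>UNIV. (if l = k then v $ l * y $ k else 0))"
      unfolding diag_def matrix_vector_mult_def vec_lambda_beta
      by (intro sum.cong) auto
    then show ?thesis by simp
  qed
  have *: "system_matrix W b \<gamma> *v x
      = diag (2 *\<^sub>R b) *v x + 2 *\<^sub>R (diag \<gamma> *v x) - diag \<gamma> *v (W *v x)"
    unfolding system_matrix_def
    by (simp add: matrix_vector_mult_add_rdistrib matrix_vector_mult_diff_rdistrib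
        scaleR_matrix_vector_assoc matrix_vector_mul_assoc)
  show ?thesis
    unfolding * vector_minus_component vector_add_component vector_scaleR_component d
    by (simp add: matrix_vector_mult_def algebra_simps)
qed

context
  fixes W :: "real^'n^'n::finite" and a b \<gamma> p :: "real^'n"
  assumes W_nonneg: "\<And>i k. 0 \<le> W $ i $ k"
    and W_diag: "\<And>i. W $ i $ i = 0"
    and W_row: "\<And>i. (\<Sum>k\<in>UNIV. W $ i $ k) = 1"
    and b_pos: "\<And>i. 0 < b $ i"
    and \<gamma>_nonneg: "\<And>i. 0 \<le> \<gamma> $ i"
    and ap_nonneg: "\<And>i. 0 \<le> a $ i - p $ i"
begin

lemma system_nonneg:
  assumes "\<And>i. 0 \<le> (system_matrix W b \<gamma> *v x) $ i"
  shows "0 \<le> x $ i"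
proof -
  have "Min (range (\<lambda>i. x $ i)) \<in> range (\<lambda>i. x $ i)" by (intro Min_in) auto
  then obtain m where m: "x $ m = Min (range (\<lambda>i. x $ i))" by (metis imageE)
  have le: "x $ m \<le> x $ k" for k unfolding m by (intro Min_le) auto
  have "x $ m = (\<Sum>k\<in>UNIV. W $ m $ k * x $ m)"
    by (simp add: sum_distrib_right[symmetric] W_row)
  also have "\<dots> \<le> (\<Sum>k\<in>UNIV. W $ m $ k * x $ k)"
    by (intro sum_mono mult_left_mono le W_nonneg)
  finally have "\<gamma> $ m * x $ m \<le> \<gamma> $ m * (\<Sum>k\<in>UNIV. W $ m $ k * x $ k)"
    by (intro mult_left_mono \<gamma>_nonneg)
  with assms[of m] have "0 \<le> (2 * b $ m + \<gamma> $ m) * x $ m"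
    unfolding system_matrix_mult by (simp add: algebra_simps)
  moreover have "0 < 2 * b $ m + \<gamma> $ m" using b_pos[of m] \<gamma>_nonneg[of m] by linarith
  ultimately have "0 \<le> x $ m" by (simp add: zero_le_mult_iff)
  with le[of i] show ?thesis by linarith
qed

lemma system_invertible: "invertible (system_matrix W b \<gamma>)"
proof -
  have "x = 0" if x: "system_matrix W b \<gamma> *v x = 0" for x
  proof -
    have "system_matrix W b \<gamma> *v (- x) = 0"
      using x matrix_vector_mult_diff_distrib[of "system_matrix W b \<gamma>" 0 x] by simp
    then have "0 \<le> (- x) $ i" "0 \<le> x $ i" for i
      using x by (rule_tac system_nonneg, simp)+
    then show ?thesis by (simp add: vec_eq_iff order_antisym)
  qed
  then show ?thesis
    by (simp add: invertible_left_inverse matrix_left_invertible_ker)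
qed

lemma system_inv:
  "system_matrix W b \<gamma> ** matrix_inv (system_matrix W b \<gamma>) = mat 1"
  "matrix_inv (system_matrix W b \<gamma>) ** system_matrix W b \<gamma> = mat 1"
  using someI_ex[OF system_invertible[unfolded invertible_def]]
  unfolding matrix_inv_def by blast+

lemma payoff_deviation:
  "payoff W a b \<gamma> p (\<chi> k. if k = i then y else x $ k) i
    = (a $ i - p $ i + \<gamma> $ i * (\<Sum>k\<in>UNIV. W $ i $ k * x $ k)) * y - (b $ i + \<gamma> $ i) * y^2"
proof -
  have "(\<Sum>k\<in>UNIV. W $ i $ k * (if k = i then y else x $ k)) = (\<Sum>k\<in>UNIV. W $ i $ k * x $ k)"
    by (intro sum.cong) (auto simp: W_diag)
  then show ?thesis
    by (simp add: payoff_def algebra_simps power2_eq_square)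
qed

lemma quadratic_max_iff:
  fixes s c z :: real
  assumes "0 < c" "0 \<le> s" "0 \<le> z"
  shows "(\<forall>y\<ge>0. s * y - c * y^2 \<le> s * z - c * z^2) \<longleftrightarrow> 2 * c * z = s"
proof
  assume *: "\<forall>y\<ge>0. s * y - c * y^2 \<le> s * z - c * z^2"
  have "0 \<le> s / (2 * c)" using assms by simp
  with * have "s * (s / (2 * c)) - c * (s / (2 * c))^2 \<le> s * z - c * z^2" by blast
  moreover have "s * z - c * z^2 - (s * (s / (2 * c)) - c * (s / (2 * c))^2) = - c * (z - s / (2 * c))^2"
    using assms(1) by (simp add: field_simps power2_eq_square)
  ultimately have "c * (z - s / (2 * c))^2 \<le> 0" by linarith
  then have "z - s / (2 * c) = 0" using assms(1) by (simp add: mult_le_0_iff)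
  then show "2 * c * z = s" using assms(1) by (simp add: field_simps)
next
  assume s: "2 * c * z = s"
  show "\<forall>y\<ge>0. s * y - c * y^2 \<le> s * z - c * z^2"
  proof (intro allI impI)
    fix y :: real
    have "s * z - c * z^2 - (s * y - c * y^2) = c * (z - y)^2"
      unfolding s[symmetric] by (simp add: algebra_simps power2_eq_square)
    moreover have "0 \<le> c * (z - y)^2" using assms(1) by simp
    ultimately show "s * y - c * y^2 \<le> s * z - c * z^2" by linarith
  qed
qed

lemma nash_equilibrium_iff:
  "nash_equilibrium W a b \<gamma> p x \<longleftrightarrow> x = matrix_inv (system_matrix W b \<gamma>) *v (a - p)"
proof -
  let ?M = "system_matrix W b \<gamma>"
  have inv: "x = matrix_inv ?M *v (a - p) \<longleftrightarrow> ?M *v x = a - p"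
  proof
    assume "x = matrix_inv ?M *v (a - p)"
    then show "?M *v x = a - p"
      by (simp add: matrix_vector_mul_assoc system_inv)
  next
    assume "?M *v x = a - p"
    then have "matrix_inv ?M *v (a - p) = (matrix_inv ?M ** ?M) *v x"
      by (simp add: matrix_vector_mul_assoc[symmetric])
    then show "x = matrix_inv ?M *v (a - p)"
      by (simp add: system_inv)
  qed
  have br: "(\<forall>y\<ge>0. payoff W a b \<gamma> p (\<chi> k. if k = i then y else x $ k) i \<le> payoff W a b \<gamma> p x i)
      \<longleftrightarrow> (?M *v x) $ i = (a - p) $ i" if x: "\<And>i. 0 \<le> x $ i" for i
  proof -
    let ?s = "a $ i - p $ i + \<gamma> $ i * (\<Sum>k\<in>UNIV. W $ i $ k * x $ k)"
    have "0 < b $ i + \<gamma> $ i" using b_pos[of i] \<gamma>_nonneg[of i] by linarith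
    moreover have "0 \<le> ?s"
      using ap_nonneg by (intro add_nonneg_nonneg mult_nonneg_nonneg sum_nonneg)
        (auto intro: x W_nonneg \<gamma>_nonneg)
    moreover have "(\<chi> k. if k = i then x $ i else x $ k) = x" by (simp add: vec_eq_iff)
    then have "payoff W a b \<gamma> p x i = ?s * x $ i - (b $ i + \<gamma> $ i) * (x $ i)^2"
      using payoff_deviation[of i "x $ i" x] by simp
    ultimately show ?thesis
      using quadratic_max_iff[of "b $ i + \<gamma> $ i" ?s "x $ i"] x[of i]
      by (auto simp: payoff_deviation system_matrix_mult)
  qed
  show ?thesis
  proof (cases "\<forall>i. 0 \<le> x $ i")
    case True
    then show ?thesis unfolding inv nash_equilibrium_def using br by (auto simp: vec_eq_iff)
  next
    case False
    moreover have "\<forall>i. 0 \<le> x $ i" if "?M *v x = a - p"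
    proof
      fix i
      show "0 \<le> x $ i" by (rule system_nonneg) (use that ap_nonneg in simp)
    qed
    ultimately show ?thesis unfolding inv nash_equilibrium_def by auto
  qed
qed

lemma equilibrium_unique: "\<exists>!x. nash_equilibrium W a b \<gamma> p x"
  by (simp add: nash_equilibrium_iff)

lemma equilibrium_eq: "equilibrium W a b \<gamma> p = matrix_inv (system_matrix W b \<gamma>) *v (a - p)"
  by (simp add: equilibrium_def nash_equilibrium_iff)

end

end

theory Submission
  imports Defs
begin

text \<open>
  Let \<open>M \<gamma> = 2 (b + \<gamma>) I - \<gamma> W\<close>, so that the equilibrium solves \<open>M \<gamma> x = a - p\<close>. For
  \<open>\<gamma> < \<gamma>'\<close> with equilibria \<open>x, x'\<close>, subtracting the two systems shows that
  \<open>y = (x - x') / (\<gamma>' - \<gamma>)\<close> solves \<open>M \<gamma>' y = 2 x - W x\<close>. Since \<open>M \<gamma>' 1 = (2 b + \<gamma>') 1\<close> and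
  \<open>M \<gamma>'\<close> is monotone, uniform bounds on a right-hand side become bounds on the solution;
  inserting these once into row \<open>i\<close> of both systems decides the sign of \<open>y\<^sub>i\<close>. For user \<open>j\<close> the
  ratio \<open>\<gamma>' / (2 b + \<gamma>') < 1/3\<close> makes \<open>y\<^sub>j > 0\<close>. For a neighbour \<open>i\<close> of \<open>j\<close>, as \<open>\<gamma>' \<rightarrow> 0\<close> the
  sign is that of \<open>\<alpha> - (\<alpha>' - \<alpha>) w\<^sub>i\<^sub>j\<close>, which is negative because \<open>w\<^sub>i\<^sub>j \<ge> 1 / (n - 1)\<close>.
\<close>

section \<open>Entries of an equal-weight row\<close>

lemma equal_weights_nonneg:
  fixes W :: "real^'n^'n::finite"
  assumes W_row: "\<And>i. (\<Sum>k\<in>UNIV. W $ i $ k) = 1"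
    and W_equal: "\<And>i k. 0 < W $ i $ k \<Longrightarrow> W $ i $ k = inverse (\<Sum>l\<in>UNIV. of_bool (0 < W $ i $ l))"
  shows "0 \<le> W $ i $ k"
proof -
  let ?P = "{l. 0 < W $ i $ l}"
  have c: "(\<Sum>l\<in>UNIV. of_bool (0 < W $ i $ l)) = real (card ?P)"
    by (simp add: of_bool_def sum.If_cases)
  have ne: "?P \<noteq> {}"
  proof
    assume "?P = {}"
    then have "(\<Sum>k\<in>UNIV. W $ i $ k) \<le> 0" by (intro sum_nonpos) (auto simp: not_less)
    then show False using W_row[of i] by simp
  qed
  \<comment> \<open>The positive entries are the reciprocal of their number, so they already exhaust
    the row sum 1. The other entries are nonpositive with sum 0, hence all zero.\<close>
  have "(\<Sum>l\<in>?P. W $ i $ l) = (\<Sum>l\<in>?P. inverse (real (card ?P)))"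
    using W_equal[of i] c by (intro sum.cong) auto
  also have "\<dots> = 1" using ne by simp
  finally have P: "(\<Sum>l\<in>?P. W $ i $ l) = 1" .
  have "(\<Sum>l\<in>UNIV. W $ i $ l) = (\<Sum>l\<in>?P. W $ i $ l) + (\<Sum>l\<in>- ?P. W $ i $ l)"
    by (subst sum.union_disjoint[symmetric]) (auto intro: sum.cong)
  then have "(\<Sum>l\<in>- ?P. W $ i $ l) = 0" using P W_row[of i] by linarith
  then have zero: "(\<Sum>l\<in>- ?P. - (W $ i $ l)) = 0" unfolding sum_negf by linarith
  have nonneg: "0 \<le> - (W $ i $ l)" if "l \<in> - ?P" for l using that by (simp add: not_less)
  have "- (W $ i $ l) = 0" if "l \<in> - ?P" for l
    by (rule sum_nonneg_0[where f = "\<lambda>l. - (W $ i $ l)", OF _ nonneg zero that]) simp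
  then show ?thesis by (cases "0 < W $ i $ k") simp_all
qed

text \<open>The zero diagonal leaves at most \<open>n - 1\<close> positive entries in row
  \<open>i\<close>, which share the total weight 1 equally.\<close>

lemma equal_weights_ge:
  fixes W :: "real^'n^'n::finite"
  assumes W_diag: "W $ i $ i = 0"
    and W_equal: "W $ i $ j = inverse (\<Sum>l\<in>UNIV. of_bool (0 < W $ i $ l))"
    and pos: "0 < W $ i $ j"
  shows "1 \<le> (real CARD('n) - 1) * W $ i $ j"
proof -
  let ?P = "{l. 0 < W $ i $ l}"
  have c: "(\<Sum>l\<in>UNIV. of_bool (0 < W $ i $ l)) = real (card ?P)"
    by (simp add: of_bool_def sum.If_cases)
  have "i \<notin> ?P" using W_diag by simp
  then have "?P \<subset> UNIV" by (metis UNIV_I psubsetI subset_UNIV)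
  then have "card ?P < CARD('n)" by (intro psubset_card_mono) simp_all
  then have "real (card ?P) \<le> real CARD('n) - 1" by linarith
  moreover have "0 < real (card ?P)" using pos by (auto simp: card_gt_0_iff)
  ultimately show ?thesis unfolding W_equal c by (simp add: field_simps)
qed

section \<open>Linear systems with uniform parameters\<close>

lemma system_matrix_uniform:
  fixes W :: "real^'n^'n::finite"
  shows "(system_matrix W (\<chi> k. b) (\<chi> k. \<gamma>) *v x) $ i
    = 2 * (b + \<gamma>) * x $ i - \<gamma> * (W *v x) $ i"
  unfolding system_matrix_mult by (simp add: matrix_vector_mult_def)

lemma system_row:
  fixes W :: "real^'n^'n::finite"
  assumes "system_matrix W (\<chi> k. b) (\<chi> k. \<gamma>) *v x = d"
  shows "2 * (b + \<gamma>) * x $ i = d $ i + \<gamma> * (W *v x) $ i"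
  using assms system_matrix_uniform[of W b \<gamma> x i] by simp

text \<open>Both systems have right-hand side \<open>d\<close>, so applying the matrix for \<gamma>'
  to \<open>x - x'\<close> leaves the change of the matrix applied to \<open>x\<close>. The quotient
  is exact, so no derivative in \<gamma> is taken.\<close>

lemma system_difference:
  fixes W :: "real^'n^'n::finite"
  assumes "system_matrix W (\<chi> k. b) (\<chi> k. \<gamma>) *v x = d"
    and "system_matrix W (\<chi> k. b) (\<chi> k. \<gamma>') *v x' = d"
    and "\<gamma> \<noteq> \<gamma>'"
  shows "system_matrix W (\<chi> k. b) (\<chi> k. \<gamma>') *v ((1 / (\<gamma>' - \<gamma>)) *\<^sub>R (x - x')) = 2 *\<^sub>R x - W *v x"
proof -
  let ?y = "(1 / (\<gamma>' - \<gamma>)) *\<^sub>R (x - x')"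
  have "(system_matrix W (\<chi> k. b) (\<chi> k. \<gamma>') *v ?y) $ i = (2 *\<^sub>R x - W *v x) $ i" for i
  proof -
    have "(system_matrix W (\<chi> k. b) (\<chi> k. \<gamma>') *v ?y) $ i
        = (2 * (b + \<gamma>') * (x $ i - x' $ i) - \<gamma>' * ((W *v x) $ i - (W *v x') $ i)) / (\<gamma>' - \<gamma>)"
      by (simp add: system_matrix_uniform matrix_vector_mult_diff_distrib matrix_vector_mult_scaleR
          diff_divide_distrib right_diff_distrib)
    also have "2 * (b + \<gamma>') * (x $ i - x' $ i) - \<gamma>' * ((W *v x) $ i - (W *v x') $ i)
        = (\<gamma>' - \<gamma>) * (2 * x $ i - (W *v x) $ i)"
      using system_row[OF assms(1), of i] system_row[OF assms(2), of i] by (simp add: algebra_simps)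
    finally show ?thesis using assms(3) by simp
  qed
  then show ?thesis by (simp add: vec_eq_iff)
qed

section \<open>Averages and comparison bounds\<close>

context
  fixes W :: "real^'n^'n::finite" and b :: real
  assumes W_nonneg: "\<And>i k. 0 \<le> W $ i $ k"
    and W_row: "\<And>i. (\<Sum>k\<in>UNIV. W $ i $ k) = 1"
    and b_pos: "0 < b"
begin

lemma average_le:
  assumes "\<And>k. W $ i $ k \<noteq> 0 \<Longrightarrow> x $ k \<le> c"
  shows "(W *v x) $ i \<le> c"
proof -
  have "(W *v x) $ i \<le> (\<Sum>k\<in>UNIV. W $ i $ k * c)"
    unfolding matrix_vector_mult_def vec_lambda_beta
    using assms by (intro sum_mono) (metis W_nonneg mult_left_mono mult_zero_left order_refl)
  then show ?thesis by (simp add: sum_distrib_right[symmetric] W_row)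
qed

lemma average_ge:
  assumes "\<And>k. W $ i $ k \<noteq> 0 \<Longrightarrow> c \<le> x $ k"
  shows "c \<le> (W *v x) $ i"
  using average_le[of i "- x" "- c"] assms matrix_vector_mult_diff_distrib[of W 0 x] by simp

text \<open>A discrete minimum principle: at a minimal coordinate \<open>m\<close> the average of
  \<open>y\<close> over row \<open>m\<close> is at least \<open>y $ m\<close>, so row
  \<open>m\<close> alone bounds \<open>y $ m\<close> from below.\<close>

lemma system_lower:
  assumes "0 \<le> \<gamma>" and "\<And>k. c \<le> (system_matrix W (\<chi> k. b) (\<chi> k. \<gamma>) *v y) $ k"
  shows "c / (2 * b + \<gamma>) \<le> y $ i"
proof -
  have "Min (range (\<lambda>i. y $ i)) \<in> range (\<lambda>i. y $ i)" by (intro Min_in) auto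
  then obtain m where m: "y $ m = Min (range (\<lambda>i. y $ i))" by (metis imageE)
  have le: "y $ m \<le> y $ k" for k unfolding m by (intro Min_le) auto
  then have "\<gamma> * y $ m \<le> \<gamma> * (W *v y) $ m"
    using assms(1) by (intro mult_left_mono average_ge) auto
  with assms(2)[of m] have "c \<le> (2 * b + \<gamma>) * y $ m"
    by (simp add: system_matrix_uniform algebra_simps)
  then have "c / (2 * b + \<gamma>) \<le> y $ m"
    using b_pos assms(1) by (simp add: pos_divide_le_eq mult.commute)
  with le[of i] show ?thesis by linarith
qed

lemma system_upper:
  assumes "0 \<le> \<gamma>" and "\<And>k. (system_matrix W (\<chi> k. b) (\<chi> k. \<gamma>) *v y) $ k \<le> c"
  shows "y $ i \<le> c / (2 * b + \<gamma>)"
  using system_lower[of \<gamma> "- c" "- y" i] assms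
    matrix_vector_mult_diff_distrib[of "system_matrix W (\<chi> k. b) (\<chi> k. \<gamma>)" 0 y]
  by simp

section \<open>Two equilibria with different parameters\<close>

context
  fixes d x x' :: "real^'n" and \<alpha> \<alpha>' \<gamma> \<gamma>' :: real and j :: 'n
  assumes \<gamma>: "0 \<le> \<gamma>" "\<gamma> < \<gamma>'"
    and x: "system_matrix W (\<chi> k. b) (\<chi> k. \<gamma>) *v x = d"
    and x': "system_matrix W (\<chi> k. b) (\<chi> k. \<gamma>') *v x' = d"
    and d_other: "\<And>k. k \<noteq> j \<Longrightarrow> d $ k = \<alpha>" and d_j: "d $ j = \<alpha>'"
    and \<alpha>: "0 < \<alpha>" "\<alpha> < \<alpha>'"
begin

lemma solution_bounds: "0 \<le> x $ k" "x $ k \<le> \<alpha>' / (2 * b + \<gamma>)"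
proof -
  have "0 \<le> d $ k" "d $ k \<le> \<alpha>'" for k using d_other[of k] d_j \<alpha> by (cases "k = j"; simp)+
  then show "0 \<le> x $ k" "x $ k \<le> \<alpha>' / (2 * b + \<gamma>)"
    using system_lower[of \<gamma> 0 x k] system_upper[of \<gamma> x \<alpha>' k] \<gamma>(1) x by auto
qed

lemma solution_ge: "d $ k \<le> 2 * (b + \<gamma>) * x $ k"
proof -
  have "0 \<le> \<gamma> * (W *v x) $ k"
    using \<gamma>(1) solution_bounds by (intro mult_nonneg_nonneg average_ge) auto
  then show ?thesis using system_row[OF x, of k] by linarith
qed

text \<open>The uniform bound enters only through the average, so a user other than \<open>j\<close>
  keeps \<alpha> as leading term.\<close>

lemma solution_le: "2 * (b + \<gamma>) * x $ k \<le> d $ k + \<gamma> * (\<alpha>' / (2 * b + \<gamma>))"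
proof -
  have "\<gamma> * (W *v x) $ k \<le> \<gamma> * (\<alpha>' / (2 * b + \<gamma>))"
    using \<gamma>(1) solution_bounds by (intro mult_left_mono average_le) auto
  then show ?thesis using system_row[OF x, of k] by linarith
qed

text \<open>In row \<open>j\<close> of the system for \<open>y\<close>, the right-hand side exceeds
  \<open>u / 3\<close>, while the feedback \<open>\<gamma>' * (W *v y) $ j\<close> is at least
  \<open>- u / 3\<close>.\<close>

lemma high_consumer_decreasing:
  assumes "W $ j $ j = 0" and "\<gamma>' < b"
  shows "x' $ j < x $ j"
proof -
  define y where "y = (1 / (\<gamma>' - \<gamma>)) *\<^sub>R (x - x')"
  have y: "system_matrix W (\<chi> k. b) (\<chi> k. \<gamma>') *v y = 2 *\<^sub>R x - W *v x"
    unfolding y_def using system_difference[OF x x'] \<gamma> by simp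
  define u where "u = \<alpha>' / (2 * b + \<gamma>)"
  have u: "0 < u" "(2 * b + \<gamma>) * u = \<alpha>'" using \<alpha> b_pos \<gamma> by (auto simp: u_def)
  have low: "- u \<le> (2 *\<^sub>R x - W *v x) $ k" for k
    using solution_bounds(1)[of k] average_le[of k x u] solution_bounds(2)[folded u_def]
    by simp
  have "- u / (2 * b + \<gamma>') \<le> (W *v y) $ j"
    using \<gamma> y low by (intro average_ge system_lower) auto
  then have "\<gamma>' * (- u / (2 * b + \<gamma>')) \<le> \<gamma>' * (W *v y) $ j"
    using \<gamma> by (intro mult_left_mono) auto
  moreover have "- u / 3 \<le> \<gamma>' * (- u / (2 * b + \<gamma>'))"
    using u(1) \<gamma> assms(2) b_pos by (simp add: field_simps)
  ultimately have Wy: "- u / 3 \<le> \<gamma>' * (W *v y) $ j" by linarith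
  have g: "\<gamma> * u \<le> \<alpha>' / 3"
    using u \<gamma> assms(2) mult_right_mono[of "3 * \<gamma>" "2 * b + \<gamma>" u] by simp
  \<comment> \<open>By the zero diagonal, row \<open>j\<close> averages only over the other users,
    so \<alpha> appears here instead of \<alpha>'.\<close>
  have "(W *v x) $ j \<le> (\<alpha> + \<gamma> * u) / (2 * (b + \<gamma>))"
  proof (rule average_le)
    fix k assume "W $ j $ k \<noteq> 0"
    then have "k \<noteq> j" using assms(1) by auto
    then show "x $ k \<le> (\<alpha> + \<gamma> * u) / (2 * (b + \<gamma>))"
      using solution_le[of k, folded u_def] d_other[of k] b_pos \<gamma>
      by (simp add: pos_le_divide_eq mult.commute)
  qed
  then have "2 * (b + \<gamma>) * (W *v x) $ j \<le> \<alpha> + \<gamma> * u"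
    using b_pos \<gamma> by (simp add: pos_le_divide_eq mult.commute)
  then have "2 * (b + \<gamma>) * (2 * x $ j - (W *v x) $ j) \<ge> 2 * \<alpha>' - \<alpha> - \<gamma> * u"
    using solution_ge[of j] d_j by (simp add: algebra_simps)
  \<comment> \<open>Since \<open>2 * (b + \<gamma>) * u = \<alpha>' + \<gamma> * u\<close>, the
    bound \<open>g\<close> reduces this to \<open>\<alpha> < 11/9 * \<alpha>'\<close>.\<close>
  moreover have "2 * \<alpha>' - \<alpha> - \<gamma> * u > 2 * (b + \<gamma>) * (u / 3)"
    using g \<alpha> u b_pos \<gamma> by (simp add: algebra_simps)
  ultimately have "2 * (b + \<gamma>) * (u / 3) < 2 * (b + \<gamma>) * (2 * x $ j - (W *v x) $ j)" by linarith
  then have "u / 3 < 2 * x $ j - (W *v x) $ j"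
    using b_pos \<gamma> by (subst (asm) mult_less_cancel_left_pos) auto
  then have "0 < 2 * (b + \<gamma>') * y $ j" using system_row[OF y, of j] Wy by simp
  then have "0 < y $ j" using b_pos \<gamma> by (simp add: zero_less_mult_iff)
  then show ?thesis using \<gamma> by (simp add: y_def zero_less_divide_iff)
qed

text \<open>The three terms of \<open>small\<close> bound \<open>2 * x $ i\<close>,
  \<open>- (W *v x) $ i\<close> and \<open>\<gamma>' * (W *v y) $ i\<close> from above. They involve
  \<gamma>' but not \<gamma>, so one threshold on \<gamma>' serves every smaller \<gamma>.\<close>

lemma neighbor_increasing:
  assumes "i \<noteq> j"
    and small: "2 * ((\<alpha> + \<gamma>' * (\<alpha>' / (2 * b))) / (2 * b))
      - (\<alpha> + (\<alpha>' - \<alpha>) * W $ i $ j) / (2 * (b + \<gamma>')) + \<gamma>' * (\<alpha>' / (2 * b\<^sup>2)) < 0"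
  shows "x $ i < x' $ i"
proof -
  define y where "y = (1 / (\<gamma>' - \<gamma>)) *\<^sub>R (x - x')"
  have y: "system_matrix W (\<chi> k. b) (\<chi> k. \<gamma>') *v y = 2 *\<^sub>R x - W *v x"
    unfolding y_def using system_difference[OF x x'] \<gamma> by simp
  have u: "\<alpha>' / (2 * b + \<gamma>) \<le> \<alpha>' / (2 * b)"
    using \<alpha> b_pos \<gamma> by (intro divide_left_mono) auto
  have up: "(2 *\<^sub>R x - W *v x) $ k \<le> \<alpha>' / b" for k
  proof -
    have "0 \<le> (W *v x) $ k" using solution_bounds(1) by (intro average_ge) auto
    moreover have "2 * (\<alpha>' / (2 * b)) = \<alpha>' / b" by simp
    ultimately show ?thesis using solution_bounds(2)[of k] u by simp
  qed
  have "(W *v y) $ i \<le> \<alpha>' / b / (2 * b + \<gamma>')"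
    using \<gamma> y up by (intro average_le system_upper) auto
  also have "\<dots> \<le> \<alpha>' / b / (2 * b)"
    using \<alpha> b_pos \<gamma> by (intro divide_left_mono) auto
  also have "\<dots> = \<alpha>' / (2 * b\<^sup>2)" by (simp add: power2_eq_square)
  finally have Wy: "\<gamma>' * (W *v y) $ i \<le> \<gamma>' * (\<alpha>' / (2 * b\<^sup>2))"
    using \<gamma> by (intro mult_left_mono) auto
  have "\<gamma> * (\<alpha>' / (2 * b + \<gamma>)) \<le> \<gamma>' * (\<alpha>' / (2 * b))"
    using u \<gamma> \<alpha> b_pos by (intro mult_mono) auto
  moreover have "2 * b * x $ i \<le> 2 * (b + \<gamma>) * x $ i"
    using solution_bounds(1)[of i] \<gamma> by (simp add: mult_right_mono)
  ultimately have "2 * b * x $ i \<le> \<alpha> + \<gamma>' * (\<alpha>' / (2 * b))"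
    using solution_le[of i] d_other[OF assms(1)] by linarith
  then have xi: "x $ i \<le> (\<alpha> + \<gamma>' * (\<alpha>' / (2 * b))) / (2 * b)"
    using b_pos by (simp add: pos_le_divide_eq mult.commute)
  \<comment> \<open>The average of \<open>d\<close> over row \<open>i\<close> is \<alpha> plus the
    excess of user \<open>j\<close> weighted by \<open>W $ i $ j\<close>; \<open>solution_ge\<close>
    passes it on to \<open>x\<close>.\<close>
  have "\<alpha> + (\<alpha>' - \<alpha>) * W $ i $ j = (\<Sum>k\<in>UNIV. W $ i $ k * \<alpha> + (if k = j then (\<alpha>' - \<alpha>) * W $ i $ j else 0))"
    by (simp add: sum.distrib sum_distrib_right[symmetric] W_row)
  also have "\<dots> = (\<Sum>k\<in>UNIV. W $ i $ k * d $ k)"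
    using d_other d_j by (intro sum.cong) (auto simp: algebra_simps)
  also have "\<dots> \<le> (\<Sum>k\<in>UNIV. W $ i $ k * (2 * (b + \<gamma>) * x $ k))"
    by (intro sum_mono mult_left_mono solution_ge W_nonneg)
  also have "\<dots> = 2 * (b + \<gamma>) * (W *v x) $ i"
    by (simp add: matrix_vector_mult_def sum_distrib_left mult_ac)
  finally have "(\<alpha> + (\<alpha>' - \<alpha>) * W $ i $ j) / (2 * (b + \<gamma>)) \<le> (W *v x) $ i"
    using b_pos \<gamma> by (simp add: pos_divide_le_eq mult.commute)
  moreover have "(\<alpha> + (\<alpha>' - \<alpha>) * W $ i $ j) / (2 * (b + \<gamma>')) \<le> (\<alpha> + (\<alpha>' - \<alpha>) * W $ i $ j) / (2 * (b + \<gamma>))"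
    using \<alpha> b_pos \<gamma> W_nonneg by (intro divide_left_mono) auto
  ultimately have "2 * (b + \<gamma>') * y $ i < 0"
    using system_row[OF y, of i] xi Wy small
    unfolding vector_minus_component vector_scaleR_component real_scaleR_def by linarith
  then have "y $ i < 0" using b_pos \<gamma> by (simp add: mult_less_0_iff)
  then show ?thesis using \<gamma> by (simp add: y_def divide_less_0_iff)
qed

end

end

theorem theorem7:
  fixes W :: "real^'n^'n::finite" and a p :: "real^'n" and b \<alpha> \<alpha>' :: real and j :: 'n
  assumes W_diag: "\<And>i. W $ i $ i = 0"
    and W_row: "\<And>i. (\<Sum>k\<in>UNIV. W $ i $ k) = 1"
    and W_equal: "\<And>i k. 0 < W $ i $ k \<Longrightarrow> W $ i $ k = inverse (\<Sum>l\<in>UNIV. of_bool (0 < W $ i $ l))"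
    and b_pos: "0 < b"
    and alpha_pos: "0 < \<alpha>"
    and others: "\<And>i. i \<noteq> j \<Longrightarrow> a $ i - p $ i = \<alpha>"
    and high: "a $ j - p $ j = \<alpha>'" "real CARD('n) * \<alpha> < \<alpha>'"
  shows "(\<forall>i \<in> {i. i \<noteq> j \<and> 0 < W $ i $ j}. \<exists>\<epsilon>. 0 < \<epsilon> \<and> \<epsilon> \<le> b \<and>
            strict_mono_on {0..<\<epsilon>} (\<lambda>\<gamma>. equilibrium W a (\<chi> k. b) (\<chi> k. \<gamma>) p $ i))
       \<and> strict_antimono_on {0..<b} (\<lambda>\<gamma>. equilibrium W a (\<chi> k. b) (\<chi> k. \<gamma>) p $ j)"
proof -
  let ?x = "\<lambda>\<gamma>. equilibrium W a (\<chi> k. b) (\<chi> k. \<gamma>) p"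
  note W_nonneg = equal_weights_nonneg[OF W_row W_equal]
  have "1 * \<alpha> \<le> real CARD('n) * \<alpha>"
    using alpha_pos by (intro mult_right_mono) (auto simp: Suc_le_eq)
  then have less: "\<alpha> < \<alpha>'" using high(2) by simp
  have ap: "0 \<le> a $ i - p $ i" for i
    using others[of i] high(1) alpha_pos less by (cases "i = j") auto
  have sys: "system_matrix W (\<chi> k. b) (\<chi> k. \<gamma>) *v ?x \<gamma> = a - p" if "0 \<le> \<gamma>" for \<gamma>
  proof -
    have b: "0 < (\<chi> k. b) $ i" and g: "0 \<le> (\<chi> k. \<gamma>) $ i" for i :: 'n
      using b_pos that by simp_all
    note uniform = W_nonneg W_diag W_row b g ap
    have "?x \<gamma> = matrix_inv (system_matrix W (\<chi> k. b) (\<chi> k. \<gamma>)) *v (a - p)"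
      by (rule equilibrium_eq[OF uniform])
    then show ?thesis
      by (simp only: matrix_vector_mul_assoc system_inv(1)[OF uniform] matrix_vector_mul_lid)
  qed
  have ap_other: "(a - p) $ k = \<alpha>" if "k \<noteq> j" for k using others[OF that] by simp
  have ap_j: "(a - p) $ j = \<alpha>'" using high(1) by simp
  note hyps = ap_other ap_j alpha_pos less
  have "strict_antimono_on {0..<b} (\<lambda>\<gamma>. ?x \<gamma> $ j)"
  proof (rule monotone_onI)
    fix \<gamma> \<gamma>' :: real assume "\<gamma> \<in> {0..<b}" "\<gamma>' \<in> {0..<b}" "\<gamma> < \<gamma>'"
    then show "?x \<gamma> $ j > ?x \<gamma>' $ j"
      using high_consumer_decreasing[OF W_nonneg W_row b_pos _ _ sys sys hyps W_diag] by auto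
  qed
  moreover have "\<exists>\<epsilon>. 0 < \<epsilon> \<and> \<epsilon> \<le> b \<and> strict_mono_on {0..<\<epsilon>} (\<lambda>\<gamma>. ?x \<gamma> $ i)"
    if "i \<noteq> j" "0 < W $ i $ j" for i
  proof -
    define F where "F t = 2 * ((\<alpha> + t * (\<alpha>' / (2 * b))) / (2 * b))
      - (\<alpha> + (\<alpha>' - \<alpha>) * W $ i $ j) / (2 * (b + t)) + t * (\<alpha>' / (2 * b\<^sup>2))" for t
    \<comment> \<open>\<open>F 0\<close> is
      \<open>(\<alpha> - (\<alpha>' - \<alpha>) * W $ i $ j) / (2 * b)\<close>. It is negative
      because the weight is at least \<open>1 / (n - 1)\<close> and
      \<open>n * \<alpha> < \<alpha>'\<close>.\<close>
    have "\<alpha> \<le> \<alpha> * ((real CARD('n) - 1) * W $ i $ j)"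
      using mult_left_mono[OF equal_weights_ge[OF W_diag W_equal[OF that(2)] that(2)], of \<alpha>]
        alpha_pos by simp
    also have "\<dots> = (real CARD('n) * \<alpha> - \<alpha>) * W $ i $ j" by (simp add: algebra_simps)
    also have "\<dots> < (\<alpha>' - \<alpha>) * W $ i $ j"
      using high(2) that(2) by (intro mult_strict_right_mono) auto
    finally have "F 0 < 0" using b_pos by (simp add: F_def field_simps)
    \<comment> \<open>A one-sided limit suffices: \<open>F\<close> is evaluated only at the larger
      parameter \<gamma>', which is positive even when \<gamma> is 0.\<close>
    moreover have "(F \<longlongrightarrow> F 0) (at_right 0)"
      unfolding F_def using b_pos by (intro tendsto_intros) auto
    ultimately have "eventually (\<lambda>t. F t < 0) (at_right 0)" by (rule order_tendstoD(2)[rotated])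
    then obtain e where e: "0 < e" "\<And>t. 0 < t \<Longrightarrow> t < e \<Longrightarrow> F t < 0"
      unfolding eventually_at_right_field by auto
    have "strict_mono_on {0..<min e b} (\<lambda>\<gamma>. ?x \<gamma> $ i)"
    proof (rule monotone_onI)
      fix \<gamma> \<gamma>' :: real assume "\<gamma> \<in> {0..<min e b}" "\<gamma>' \<in> {0..<min e b}" "\<gamma> < \<gamma>'"
      then show "?x \<gamma> $ i < ?x \<gamma>' $ i"
        using neighbor_increasing[OF W_nonneg W_row b_pos _ _ sys sys hyps that(1)]
          e(2)[of \<gamma>'] unfolding F_def by auto
    qed
    then show ?thesis using e(1) b_pos by (intro exI[of _ "min e b"]) auto
  qed
  ultimately show ?thesis by blast
qed

end
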